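(* The following two assertions are equivalent: (A) For every finite primitive permutation group $G\leqslant \mathrm{Sym}(\Omega)$ with $b(G)=2$, the set $\Sigma(\alpha)\cap\Sigma(\beta)$ is non-empty for all $\alpha,\beta\in\Omega$ (any two vertices in the Saxl graph of $G$ have a common neighbour). (B) For every finite primitive permutation group $G\leqslant \mathrm{Sym}(\Omega)$ with $b(G)=2$ and all $\alpha,\beta\in\Omega$, the set $\Sigma(\alpha)$ meets every regular $G_\beta$-orbit on $\Omega$.
   Context: $b(G)$ is the base size of $G$ (minimal size of a subset of $\Omega$ with trivial pointwise stabiliser). For $b(G)=2$, the Saxl graph $\Sigma(G)$ has vertex set $\Omega$, with two vertices joined by an edge if and only if they form a base for $G$; $\Sigma(\alpha)=\{\gamma\in\Omega: G_\alpha\cap G_\gamma=1\}$ is the set of neighbours of $\alpha$ in $\Sigma(G)$, which is the union of the regular $G_\alpha$-orbits on $\Omega$. *)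

theory Defs
  imports "HOL-Algebra.Group_Action" "HOL-Library.Infinite_Typeclass"
begin

text \<open>
  A permutation group on \<open>\<Omega>\<close> is a subgroup of \<^const>\<open>BijGroup\<close> \<open>\<Omega>\<close>, given by its carrier \<open>G\<close>.
  Its elements are themselves functions, so the action map taken by the library notions
  \<^const>\<open>orbit\<close>, \<^const>\<open>stabilizer\<close>, \<dots> is the identity \<open>\<lambda>g. g\<close>.

  The class \<open>infinite\<close> on the type of points plays only the role of a universe: an infinite
  type contains a copy of every finite set, so quantifying over the finite subsets \<open>\<Omega>\<close> of it
  is quantifying over all finite permutation groups up to permutation isomorphism.
\<close>

abbreviation perm_group :: "'a set \<Rightarrow> ('a \<Rightarrow> 'a) set \<Rightarrow> ('a \<Rightarrow> 'a) monoid" where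
  "perm_group \<Omega> G \<equiv> (BijGroup \<Omega>)\<lparr>carrier := G\<rparr>"

definition primitive_group :: "'a set \<Rightarrow> ('a \<Rightarrow> 'a) set \<Rightarrow> bool" where
  "primitive_group \<Omega> G \<longleftrightarrow>
     \<Omega> \<noteq> {} \<and> subgroup G (BijGroup \<Omega>) \<and>
     transitive_action (perm_group \<Omega> G) \<Omega> (\<lambda>g. g) \<and>
     (\<forall>R. equiv \<Omega> R \<and> (\<forall>g\<in>G. \<forall>(x, y)\<in>R. (g x, g y) \<in> R) \<longrightarrow> R = Id_on \<Omega> \<or> R = \<Omega> \<times> \<Omega>)"

definition point_stab :: "'a set \<Rightarrow> ('a \<Rightarrow> 'a) set \<Rightarrow> 'a \<Rightarrow> ('a \<Rightarrow> 'a) set" where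
  "point_stab \<Omega> G \<alpha> = stabilizer (perm_group \<Omega> G) (\<lambda>g. g) \<alpha>"

definition is_base :: "'a set \<Rightarrow> ('a \<Rightarrow> 'a) set \<Rightarrow> 'a set \<Rightarrow> bool" where
  "is_base \<Omega> G B \<longleftrightarrow> B \<subseteq> \<Omega> \<and> {g \<in> G. \<forall>b\<in>B. g b = b} = {\<one>\<^bsub>BijGroup \<Omega>\<^esub>}"

text \<open>The following is meant for finite \<open>\<Omega>\<close>, where \<open>\<Omega>\<close> itself is a base.\<close>

definition base_size :: "'a set \<Rightarrow> ('a \<Rightarrow> 'a) set \<Rightarrow> nat" where
  "base_size \<Omega> G = (LEAST n. \<exists>B. finite B \<and> card B = n \<and> is_base \<Omega> G B)"

definition saxl_nbrs :: "'a set \<Rightarrow> ('a \<Rightarrow> 'a) set \<Rightarrow> 'a \<Rightarrow> 'a set" where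
  "saxl_nbrs \<Omega> G \<alpha> = {\<gamma> \<in> \<Omega>. point_stab \<Omega> G \<alpha> \<inter> point_stab \<Omega> G \<gamma> = {\<one>\<^bsub>BijGroup \<Omega>\<^esub>}}"

text \<open>A regular orbit of \<open>H\<close> is one on which \<open>H\<close> acts regularly, i.e. (transitively and) with
  trivial point stabilisers.\<close>

definition regular_orbits :: "'a set \<Rightarrow> ('a \<Rightarrow> 'a) set \<Rightarrow> 'a set set" where
  "regular_orbits \<Omega> H =
     {D \<in> orbits (perm_group \<Omega> H) \<Omega> (\<lambda>g. g). \<forall>\<gamma>\<in>D. point_stab \<Omega> H \<gamma> = {\<one>\<^bsub>BijGroup \<Omega>\<^esub>}}"

text \<open>When the base size is 2, \<^const>\<open>saxl_nbrs\<close> is the neighbourhood in the graph on \<open>\<Omega>\<close>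
  whose edges are the bases consisting of two distinct points.\<close>

lemma saxl_nbrs_iff:
  assumes "base_size \<Omega> G = 2" "\<alpha> \<in> \<Omega>"
  shows "\<gamma> \<in> saxl_nbrs \<Omega> G \<alpha> \<longleftrightarrow> \<alpha> \<noteq> \<gamma> \<and> is_base \<Omega> G {\<alpha>, \<gamma>}"
proof -
  have "\<not> is_base \<Omega> G {\<alpha>}"
  proof
    assume "is_base \<Omega> G {\<alpha>}"
    then have "\<exists>B. finite B \<and> card B = 1 \<and> is_base \<Omega> G B"
      by (intro exI[of _ "{\<alpha>}"]) auto
    then have "base_size \<Omega> G \<le> 1"
      unfolding base_size_def by (rule Least_le)
    with assms(1) show False by simp
  qed
  moreover have "point_stab \<Omega> G \<alpha> \<inter> point_stab \<Omega> G \<gamma> = {g \<in> G. \<forall>b\<in>{\<alpha>, \<gamma>}. g b = b}"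
    by (auto simp: point_stab_def stabilizer_def)
  ultimately show ?thesis
    using assms(2) by (auto simp: saxl_nbrs_def is_base_def)
qed

end

theory Submission
  imports Defs "HOL-Combinatorics.Permutations"
begin

text \<open>
  A neighbourhood \<open>\<Sigma>(\<beta>)\<close> is a non-empty union of regular \<open>G\<^sub>\<beta>\<close>-orbits, so (B) implies (A). For the
  converse, let \<open>I\<close> be the set of regular \<open>G\<^sub>\<beta>\<close>-orbits and let \<open>W\<close> be the wreath product of \<open>G\<close> with
  \<open>Sym(I)\<close> in its product action on \<open>\<Omega>\<^sup>I\<close>. Since \<open>G\<close> is primitive and not regular, \<open>W\<close> is primitive. A
  point \<open>c\<close> is a neighbour of the constant tuple \<open>(\<beta>, \<dots>, \<beta>)\<close> if and only if its coordinates lie in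
  pairwise distinct regular \<open>G\<^sub>\<beta>\<close>-orbits; such \<open>c\<close> exists by the choice of \<open>I\<close>, so \<open>W\<close> has base size 2.
  By (A) the constant tuples of \<open>\<alpha>\<close> and \<open>\<beta>\<close> have a common neighbour; its coordinates all lie in
  \<open>\<Sigma>(\<alpha>)\<close> and, there being exactly \<open>|I|\<close> of them, they meet every regular \<open>G\<^sub>\<beta>\<close>-orbit.
\<close>

section \<open>Permutation groups\<close>

lemma BijGroup_simps:
  "carrier (BijGroup \<Omega>) = Bij \<Omega>"
  "\<one>\<^bsub>BijGroup \<Omega>\<^esub> = (\<lambda>x\<in>\<Omega>. x)"
  "g \<in> Bij \<Omega> \<Longrightarrow> h \<in> Bij \<Omega> \<Longrightarrow> g \<otimes>\<^bsub>BijGroup \<Omega>\<^esub> h = compose \<Omega> g h"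
  by (simp_all add: BijGroup_def)

text \<open>Serves twice: it extracts the closure properties of \<open>G\<close>, and it reduces the
  proof that the wreath product is a subgroup to elementary closure checks.\<close>

lemma subgroup_BijGroup_iff:
  "subgroup G (BijGroup \<Omega>) \<longleftrightarrow>
     G \<subseteq> Bij \<Omega> \<and> (\<lambda>x\<in>\<Omega>. x) \<in> G \<and> (\<forall>g\<in>G. \<forall>h\<in>G. compose \<Omega> g h \<in> G) \<and>
     (\<forall>g\<in>G. restrict (inv_into \<Omega> g) \<Omega> \<in> G)"
proof
  assume sub: "subgroup G (BijGroup \<Omega>)"
  have Bij: "G \<subseteq> Bij \<Omega>"
    using subgroup.subset[OF sub] by (simp add: BijGroup_def)
  moreover have "(\<lambda>x\<in>\<Omega>. x) \<in> G"
    using subgroup.one_closed[OF sub] by (simp add: BijGroup_def)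
  moreover have "compose \<Omega> g h \<in> G" if "g \<in> G" "h \<in> G" for g h
    using subgroup.m_closed[OF sub that] Bij that by (auto simp: BijGroup_def subset_iff)
  moreover have "restrict (inv_into \<Omega> g) \<Omega> \<in> G" if "g \<in> G" for g
    using subgroup.m_inv_closed[OF sub that] inv_BijGroup[of g \<Omega>] Bij that by auto
  ultimately show "G \<subseteq> Bij \<Omega> \<and> (\<lambda>x\<in>\<Omega>. x) \<in> G \<and> (\<forall>g\<in>G. \<forall>h\<in>G. compose \<Omega> g h \<in> G) \<and>
      (\<forall>g\<in>G. restrict (inv_into \<Omega> g) \<Omega> \<in> G)"
    by blast
next
  assume "G \<subseteq> Bij \<Omega> \<and> (\<lambda>x\<in>\<Omega>. x) \<in> G \<and> (\<forall>g\<in>G. \<forall>h\<in>G. compose \<Omega> g h \<in> G) \<and>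
      (\<forall>g\<in>G. restrict (inv_into \<Omega> g) \<Omega> \<in> G)"
  then show "subgroup G (BijGroup \<Omega>)"
    by (intro subgroup.intro) (auto simp: BijGroup_simps inv_BijGroup subset_iff)
qed

locale permutation_group =
  fixes \<Omega> :: "'a set" and G :: "('a \<Rightarrow> 'a) set"
  assumes subgroup_G: "subgroup G (BijGroup \<Omega>)"
begin

text \<open>The restriction makes the inverse extensional, as every element of
  \<open>Bij \<Omega>\<close> has to be, so that it lies in \<open>G\<close> again.\<close>

definition ginv :: "('a \<Rightarrow> 'a) \<Rightarrow> 'a \<Rightarrow> 'a"
  where "ginv g = restrict (inv_into \<Omega> g) \<Omega>"

lemma in_Bij: "g \<in> G \<Longrightarrow> g \<in> Bij \<Omega>"
  and one_closed: "(\<lambda>x\<in>\<Omega>. x) \<in> G"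
  and compose_closed: "g \<in> G \<Longrightarrow> h \<in> G \<Longrightarrow> compose \<Omega> g h \<in> G"
  and ginv_closed: "g \<in> G \<Longrightarrow> ginv g \<in> G"
  using subgroup_G by (auto simp: subgroup_BijGroup_iff ginv_def)

lemma closed: "g \<in> G \<Longrightarrow> x \<in> \<Omega> \<Longrightarrow> g x \<in> \<Omega>"
  using in_Bij Bij_imp_funcset by blast

lemma ginv_left: "g \<in> G \<Longrightarrow> x \<in> \<Omega> \<Longrightarrow> ginv g (g x) = x"
  using in_Bij[of g] closed[of g x]
  by (auto simp: ginv_def Bij_def bij_betw_def inv_into_f_f)

lemma ginv_right: "g \<in> G \<Longrightarrow> x \<in> \<Omega> \<Longrightarrow> g (ginv g x) = x"
  using in_Bij[of g] by (auto simp: ginv_def Bij_def bij_betw_def f_inv_into_f)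

lemma eqI: "g \<in> G \<Longrightarrow> h \<in> G \<Longrightarrow> (\<And>x. x \<in> \<Omega> \<Longrightarrow> g x = h x) \<Longrightarrow> g = h"
  by (meson Bij_imp_extensional extensionalityI in_Bij)

lemma inj: "g \<in> G \<Longrightarrow> x \<in> \<Omega> \<Longrightarrow> y \<in> \<Omega> \<Longrightarrow> g x = g y \<longleftrightarrow> x = y"
  using ginv_left by metis

text \<open>Together with \<open>conj_eq_one\<close> this moves questions about stabilisers of
  \<open>g x\<close> back to stabilisers of \<open>x\<close>.\<close>

lemma conj_fixes_iff:
  assumes "g \<in> G" "h \<in> G" "x \<in> \<Omega>"
  shows "compose \<Omega> (ginv g) (compose \<Omega> h g) x = x \<longleftrightarrow> h (g x) = g x"
  using assms ginv_left ginv_right closed ginv_closed compose_eq by metis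

lemma conj_closed: "g \<in> G \<Longrightarrow> h \<in> G \<Longrightarrow> compose \<Omega> (ginv g) (compose \<Omega> h g) \<in> G"
  by (intro compose_closed ginv_closed)

lemma conj_eq_one:
  assumes "g \<in> G" "h \<in> G" "compose \<Omega> (ginv g) (compose \<Omega> h g) = (\<lambda>x\<in>\<Omega>. x)"
  shows "h = (\<lambda>x\<in>\<Omega>. x)"
proof (rule eqI)
  fix x assume x: "x \<in> \<Omega>"
  then have "ginv g x \<in> \<Omega>" using assms closed ginv_closed by blast
  then have "h (g (ginv g x)) = g (ginv g x)"
    using conj_fixes_iff[of g h "ginv g x"] assms by simp
  then show "h x = (\<lambda>x\<in>\<Omega>. x) x" using ginv_right[OF assms(1) x] x by simp
qed (use assms one_closed in auto)

section \<open>Saxl neighbourhoods and the orbits of a point stabiliser\<close>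

lemma saxl_nbrs_eq:
  "saxl_nbrs \<Omega> G \<alpha> = {\<gamma> \<in> \<Omega>. \<forall>g\<in>G. g \<alpha> = \<alpha> \<longrightarrow> g \<gamma> = \<gamma> \<longrightarrow> g = (\<lambda>x\<in>\<Omega>. x)}"
  if "\<alpha> \<in> \<Omega>"
  using that one_closed
  by (auto simp: saxl_nbrs_def point_stab_def stabilizer_def BijGroup_def)

definition stab_orbit :: "'a \<Rightarrow> 'a \<Rightarrow> 'a set"
  where "stab_orbit \<beta> \<gamma> = {h \<gamma> |h. h \<in> G \<and> h \<beta> = \<beta>}"

lemma stab_orbit_refl: "\<beta> \<in> \<Omega> \<Longrightarrow> \<gamma> \<in> \<Omega> \<Longrightarrow> \<gamma> \<in> stab_orbit \<beta> \<gamma>"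
  unfolding stab_orbit_def using one_closed by (intro CollectI exI[of _ "\<lambda>x\<in>\<Omega>. x"]) simp

lemma stab_orbit_mono:
  assumes "\<beta> \<in> \<Omega>" "\<gamma> \<in> \<Omega>" "\<delta> \<in> stab_orbit \<beta> \<gamma>"
  shows "stab_orbit \<beta> \<delta> \<subseteq> stab_orbit \<beta> \<gamma>"
proof
  fix x assume "x \<in> stab_orbit \<beta> \<delta>"
  with assms obtain h k where "h \<in> G" "h \<beta> = \<beta>" "k \<in> G" "k \<beta> = \<beta>" "x = h (k \<gamma>)"
    by (auto simp: stab_orbit_def)
  with assms show "x \<in> stab_orbit \<beta> \<gamma>"
    unfolding stab_orbit_def
    by (intro CollectI exI[of _ "compose \<Omega> h k"]) (simp add: compose_eq compose_closed)
qed

lemma stab_orbit_sym: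
  assumes "\<beta> \<in> \<Omega>" "\<gamma> \<in> \<Omega>" "\<delta> \<in> stab_orbit \<beta> \<gamma>"
  shows "\<gamma> \<in> stab_orbit \<beta> \<delta>"
proof -
  obtain h where h: "h \<in> G" "h \<beta> = \<beta>" "\<delta> = h \<gamma>"
    using assms by (auto simp: stab_orbit_def)
  then have "ginv h \<beta> = \<beta>" "ginv h \<delta> = \<gamma>"
    using ginv_left[OF h(1)] assms by metis+
  with ginv_closed[OF h(1)] show ?thesis
    by (auto simp: stab_orbit_def)
qed

lemma stab_orbit_cong:
  assumes "\<beta> \<in> \<Omega>" "\<gamma> \<in> \<Omega>" "\<delta> \<in> stab_orbit \<beta> \<gamma>"
  shows "stab_orbit \<beta> \<delta> = stab_orbit \<beta> \<gamma>"
proof -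
  have "\<delta> \<in> \<Omega>" using assms closed by (auto simp: stab_orbit_def)
  then show ?thesis
    using stab_orbit_mono stab_orbit_sym assms by (meson subset_antisym)
qed

text \<open>Let \<open>h\<close> fix \<beta>. An element fixing \<beta> and
  \<open>h \<gamma>\<close> is conjugated by \<open>h\<close> to one fixing \<beta> and \<gamma>,
  which is trivial.\<close>

lemma stab_orbit_saxl_nbrs:
  assumes "\<beta> \<in> \<Omega>" "\<gamma> \<in> saxl_nbrs \<Omega> G \<beta>"
  shows "stab_orbit \<beta> \<gamma> \<subseteq> saxl_nbrs \<Omega> G \<beta>"
proof
  fix \<delta> assume "\<delta> \<in> stab_orbit \<beta> \<gamma>"
  then obtain h where h: "h \<in> G" "h \<beta> = \<beta>" "\<delta> = h \<gamma>"
    by (auto simp: stab_orbit_def)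
  have \<gamma>: "\<gamma> \<in> \<Omega>" "\<And>g. g \<in> G \<Longrightarrow> g \<beta> = \<beta> \<Longrightarrow> g \<gamma> = \<gamma> \<Longrightarrow> g = (\<lambda>x\<in>\<Omega>. x)"
    using assms by (auto simp: saxl_nbrs_eq)
  have "g = (\<lambda>x\<in>\<Omega>. x)" if "g \<in> G" "g \<beta> = \<beta>" "g \<delta> = \<delta>" for g
    using conj_eq_one[OF h(1) that(1)] conj_fixes_iff[OF h(1) that(1)] conj_closed[OF h(1) that(1)]
      \<gamma> that assms(1) h by metis
  then show "\<delta> \<in> saxl_nbrs \<Omega> G \<beta>"
    using h \<gamma> closed assms by (simp add: saxl_nbrs_eq)
qed

text \<open>Inside the stabiliser of \<beta>, the stabiliser of \<gamma> is the intersection of both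
  point stabilisers, so regularity at \<gamma> means being a neighbour of \<beta>. By
  \<open>stab_orbit_saxl_nbrs\<close> this spreads from one point to its whole orbit.\<close>

lemma regular_orbits_eq:
  assumes "\<beta> \<in> \<Omega>"
  shows "regular_orbits \<Omega> (point_stab \<Omega> G \<beta>) = stab_orbit \<beta> ` saxl_nbrs \<Omega> G \<beta>"
proof -
  have orb: "orbit (perm_group \<Omega> (point_stab \<Omega> G \<beta>)) (\<lambda>g. g) \<gamma> = stab_orbit \<beta> \<gamma>" for \<gamma>
    by (auto simp: orbit_def stab_orbit_def point_stab_def stabilizer_def)
  have stab: "point_stab \<Omega> (point_stab \<Omega> G \<beta>) \<gamma> = {\<one>\<^bsub>BijGroup \<Omega>\<^esub>} \<longleftrightarrow> \<gamma> \<in> saxl_nbrs \<Omega> G \<beta>"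
    if "\<gamma> \<in> \<Omega>" for \<gamma>
  proof -
    have "point_stab \<Omega> (point_stab \<Omega> G \<beta>) \<gamma> = point_stab \<Omega> G \<beta> \<inter> point_stab \<Omega> G \<gamma>"
      by (auto simp: point_stab_def stabilizer_def)
    then show ?thesis using that by (simp add: saxl_nbrs_def)
  qed
  show ?thesis
  proof (intro equalityI subsetI)
    fix D assume "D \<in> regular_orbits \<Omega> (point_stab \<Omega> G \<beta>)"
    then obtain \<gamma> where \<gamma>: "\<gamma> \<in> \<Omega>" "D = stab_orbit \<beta> \<gamma>"
      and "\<forall>\<delta>\<in>D. point_stab \<Omega> (point_stab \<Omega> G \<beta>) \<delta> = {\<one>\<^bsub>BijGroup \<Omega>\<^esub>}"
      by (auto simp: regular_orbits_def orbits_def orb)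
    then have "\<gamma> \<in> saxl_nbrs \<Omega> G \<beta>"
      using stab_orbit_refl[OF assms \<gamma>(1)] stab[OF \<gamma>(1)] by blast
    with \<gamma> show "D \<in> stab_orbit \<beta> ` saxl_nbrs \<Omega> G \<beta>" by simp
  next
    fix D assume "D \<in> stab_orbit \<beta> ` saxl_nbrs \<Omega> G \<beta>"
    then obtain \<gamma> where \<gamma>: "\<gamma> \<in> saxl_nbrs \<Omega> G \<beta>" "D = stab_orbit \<beta> \<gamma>" by blast
    have sub: "saxl_nbrs \<Omega> G \<beta> \<subseteq> \<Omega>" by (auto simp: saxl_nbrs_def)
    have "point_stab \<Omega> (point_stab \<Omega> G \<beta>) \<delta> = {\<one>\<^bsub>BijGroup \<Omega>\<^esub>}" if "\<delta> \<in> D" for \<delta>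
    proof -
      have "\<delta> \<in> saxl_nbrs \<Omega> G \<beta>"
        using stab_orbit_saxl_nbrs[OF assms \<gamma>(1)] that \<gamma>(2) by blast
      then show ?thesis using stab sub by blast
    qed
    moreover have "D \<in> orbits (perm_group \<Omega> (point_stab \<Omega> G \<beta>)) \<Omega> (\<lambda>g. g)"
      unfolding orbits_def orb using \<gamma> sub by blast
    ultimately show "D \<in> regular_orbits \<Omega> (point_stab \<Omega> G \<beta>)"
      by (simp add: regular_orbits_def)
  qed
qed

end

section \<open>Primitive groups of base size two\<close>

text \<open>The inclusion of \<open>G\<close> in \<open>BijGroup \<Omega>\<close> is a homomorphism,
  hence an action, so transitivity in the library's sense unfolds to the elementary
  condition.\<close>

lemma primitive_group_iff:
  "primitive_group \<Omega> G \<longleftrightarrow>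
     \<Omega> \<noteq> {} \<and> subgroup G (BijGroup \<Omega>) \<and> (\<forall>x\<in>\<Omega>. \<forall>y\<in>\<Omega>. \<exists>g\<in>G. g x = y) \<and>
     (\<forall>R. equiv \<Omega> R \<and> (\<forall>g\<in>G. \<forall>(x, y)\<in>R. (g x, g y) \<in> R) \<longrightarrow> R = Id_on \<Omega> \<or> R = \<Omega> \<times> \<Omega>)"
proof -
  have "transitive_action (perm_group \<Omega> G) \<Omega> (\<lambda>g. g) \<longleftrightarrow> (\<forall>x\<in>\<Omega>. \<forall>y\<in>\<Omega>. \<exists>g\<in>G. g x = y)"
    if sub: "subgroup G (BijGroup \<Omega>)"
  proof -
    have "group_hom (perm_group \<Omega> G) (BijGroup \<Omega>) (\<lambda>g. g)"
      using subgroup.subgroup_is_group[OF sub group_BijGroup] group_BijGroup subgroup.subset[OF sub]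
      by (auto simp: group_hom_def group_hom_axioms_def hom_def)
    then show ?thesis
      by (auto simp: transitive_action_def transitive_action_axioms_def group_action_def)
  qed
  then show ?thesis
    unfolding primitive_group_def by blast
qed

lemma base_size_eq_2:
  assumes "is_base \<Omega> G {\<alpha>, \<beta>}" "\<And>\<gamma>. \<gamma> \<in> \<Omega> \<Longrightarrow> \<not> is_base \<Omega> G {\<gamma>}"
  shows "base_size \<Omega> G = 2"
  unfolding base_size_def
proof (rule Least_equality)
  have "\<alpha> \<noteq> \<beta>" using assms by (auto simp: is_base_def)
  then show "\<exists>B. finite B \<and> card B = 2 \<and> is_base \<Omega> G B"
    using assms(1) by (intro exI[of _ "{\<alpha>, \<beta>}"]) simp
next
  fix n assume "\<exists>B. finite B \<and> card B = n \<and> is_base \<Omega> G B"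
  then obtain B where B: "finite B" "card B = n" "is_base \<Omega> G B" by blast
  show "2 \<le> n"
  proof (rule ccontr)
    assume "\<not> 2 \<le> n"
    then have "card B \<le> 1" using B(2) by linarith
    moreover have "\<alpha> \<in> \<Omega>" using assms(1) by (simp add: is_base_def)
    ultimately obtain \<gamma> where \<gamma>: "\<gamma> \<in> \<Omega>" "B \<subseteq> {\<gamma>}"
      using B(1,3) by (auto simp: le_Suc_eq card_1_singleton_iff is_base_def)
    \<comment> \<open>If \<open>B\<close> is empty, it is enlarged to \<open>{\<gamma>}\<close>.
      This remains a base because the identity still fixes \<gamma>.\<close>
    have "\<one>\<^bsub>BijGroup \<Omega>\<^esub> \<gamma> = \<gamma>"
      using \<gamma>(1) by (simp add: BijGroup_simps)
    then have "is_base \<Omega> G {\<gamma>}"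
      using B(3) \<gamma> by (auto simp: is_base_def subset_singleton_iff)
    with assms(2) \<gamma>(1) show False by blast
  qed
qed

lemma is_base_iff_saxl_nbrs:
  assumes "\<alpha> \<in> \<Omega>"
  shows "is_base \<Omega> G {\<alpha>, \<gamma>} \<longleftrightarrow> \<gamma> \<in> saxl_nbrs \<Omega> G \<alpha>"
proof -
  have "{g \<in> G. \<forall>b\<in>{\<alpha>, \<gamma>}. g b = b} = point_stab \<Omega> G \<alpha> \<inter> point_stab \<Omega> G \<gamma>"
    by (auto simp: point_stab_def stabilizer_def)
  then show ?thesis using assms by (simp add: is_base_def saxl_nbrs_def)
qed

locale primitive_base2 = permutation_group +
  assumes finite: "finite \<Omega>"
    and primitive: "primitive_group \<Omega> G"
    and base2: "base_size \<Omega> G = 2"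
begin

lemma nonempty: "\<Omega> \<noteq> {}"
  and transitive: "x \<in> \<Omega> \<Longrightarrow> y \<in> \<Omega> \<Longrightarrow> \<exists>g\<in>G. g x = y"
proof -
  have "\<forall>x\<in>\<Omega>. \<forall>y\<in>\<Omega>. \<exists>g\<in>G. g x = y"
    using primitive unfolding primitive_group_iff by (elim conjE)
  then show "x \<in> \<Omega> \<Longrightarrow> y \<in> \<Omega> \<Longrightarrow> \<exists>g\<in>G. g x = y" by blast
qed (use primitive in \<open>simp add: primitive_group_def\<close>)

lemma blocks:
  assumes "equiv \<Omega> R" "\<And>g x y. g \<in> G \<Longrightarrow> (x, y) \<in> R \<Longrightarrow> (g x, g y) \<in> R"
  shows "R = Id_on \<Omega> \<or> R = \<Omega> \<times> \<Omega>"
proof -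
  have "\<forall>R. equiv \<Omega> R \<and> (\<forall>g\<in>G. \<forall>(x, y)\<in>R. (g x, g y) \<in> R) \<longrightarrow> R = Id_on \<Omega> \<or> R = \<Omega> \<times> \<Omega>"
    using primitive unfolding primitive_group_iff by (elim conjE)
  moreover have "\<forall>g\<in>G. \<forall>(x, y)\<in>R. (g x, g y) \<in> R"
    using assms(2) by auto
  ultimately show ?thesis using assms(1) by simp
qed

text \<open>A trivial stabiliser would make \<open>{x}\<close> a base, against base size 2. In this
  form the non-regularity of \<open>G\<close> enters the primitivity proof for the wreath
  product.\<close>

lemma nontrivial_stab:
  assumes "x \<in> \<Omega>"
  shows "\<exists>g\<in>G. g x = x \<and> g \<noteq> (\<lambda>x\<in>\<Omega>. x)"
proof (rule ccontr)
  assume "\<not> ?thesis"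
  then have "{g \<in> G. g x = x} \<subseteq> {\<lambda>x\<in>\<Omega>. x}" by blast
  moreover have "(\<lambda>x\<in>\<Omega>. x) \<in> {g \<in> G. g x = x}" using assms one_closed by simp
  ultimately have "{g \<in> G. g x = x} = {\<lambda>x\<in>\<Omega>. x}" by blast
  then have "is_base \<Omega> G {x}"
    using assms by (simp add: is_base_def BijGroup_simps)
  then have "base_size \<Omega> G \<le> 1"
    unfolding base_size_def by (intro Least_le exI[of _ "{x}"]) simp
  with base2 show False by simp
qed

text \<open>Having equal stabilisers is a \<open>G\<close>-invariant equivalence relation, so by
  primitivity it is equality or universal. In the universal case an element fixing one point fixes
  all of them, which contradicts \<open>nontrivial_stab\<close>.\<close>

lemma stab_distinct:
  assumes "x \<in> \<Omega>" "y \<in> \<Omega>" "x \<noteq> y"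
  shows "\<exists>g\<in>G. (g x = x) \<noteq> (g y = y)"
proof -
  let ?R = "{(x, y) \<in> \<Omega> \<times> \<Omega>. \<forall>g\<in>G. g x = x \<longleftrightarrow> g y = y}"
  have "equiv \<Omega> ?R"
    by (rule equivI) (auto simp: refl_on_def sym_def trans_def)
  moreover have "(g x, g y) \<in> ?R" if "g \<in> G" "(x, y) \<in> ?R" for g x y
  proof -
    have "h (g x) = g x \<longleftrightarrow> h (g y) = g y" if "h \<in> G" for h
    proof -
      have "compose \<Omega> (ginv g) (compose \<Omega> h g) \<in> G"
        using \<open>g \<in> G\<close> that by (rule conj_closed)
      then have "compose \<Omega> (ginv g) (compose \<Omega> h g) x = x \<longleftrightarrow>
          compose \<Omega> (ginv g) (compose \<Omega> h g) y = y"
        using \<open>(x, y) \<in> ?R\<close> by blast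
      then show ?thesis
        using conj_fixes_iff[OF \<open>g \<in> G\<close> that] \<open>(x, y) \<in> ?R\<close> by simp
    qed
    then show ?thesis using that closed by simp
  qed
  ultimately consider "?R = Id_on \<Omega>" | "?R = \<Omega> \<times> \<Omega>"
    using blocks[of ?R] by presburger
  then show ?thesis
  proof cases
    case 1
    with assms have "(x, y) \<notin> ?R" by auto
    with assms show ?thesis by auto
  next
    case 2
    obtain g where g: "g \<in> G" "g x = x" "g \<noteq> (\<lambda>x\<in>\<Omega>. x)"
      using nontrivial_stab assms by blast
    have "g z = z" if "z \<in> \<Omega>" for z
    proof -
      have "(x, z) \<in> ?R" using 2 assms that by blast
      with g show ?thesis by auto
    qed
    then have "g = (\<lambda>x\<in>\<Omega>. x)" using g one_closed by (intro eqI) auto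
    with g show ?thesis by simp
  qed
qed

lemma ex_distinct: "\<exists>x\<in>\<Omega>. \<exists>y\<in>\<Omega>. x \<noteq> y"
proof -
  obtain x where x: "x \<in> \<Omega>" using nonempty by blast
  then obtain g where g: "g \<in> G" "g \<noteq> (\<lambda>x\<in>\<Omega>. x)" using nontrivial_stab by blast
  then have "\<not> (\<forall>y\<in>\<Omega>. g y = y)"
    using eqI[OF g(1) one_closed] by (metis restrict_apply')
  then obtain y where "y \<in> \<Omega>" "g y \<noteq> y" by blast
  with closed g show ?thesis by blast
qed

text \<open>Since \<Omega> is finite and itself a base, the minimum in \<open>base_size\<close> is
  attained and a base \<open>{x, y}\<close> exists. Transitivity carries \<open>x\<close> to
  \<alpha>, and \<open>y\<close> to a neighbour of \<alpha>.\<close>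

lemma saxl_nbrs_nonempty:
  assumes "\<alpha> \<in> \<Omega>"
  shows "saxl_nbrs \<Omega> G \<alpha> \<noteq> {}"
proof -
  have "g = (\<lambda>x\<in>\<Omega>. x)" if "g \<in> G" "\<forall>x\<in>\<Omega>. g x = x" for g
    by (rule eqI[OF that(1) one_closed]) (use that(2) in simp)
  then have "{g \<in> G. \<forall>x\<in>\<Omega>. g x = x} \<subseteq> {\<lambda>x\<in>\<Omega>. x}" by blast
  moreover have "(\<lambda>x\<in>\<Omega>. x) \<in> {g \<in> G. \<forall>x\<in>\<Omega>. g x = x}" using one_closed by simp
  ultimately have "{g \<in> G. \<forall>x\<in>\<Omega>. g x = x} = {\<lambda>x\<in>\<Omega>. x}" by blast
  then have "is_base \<Omega> G \<Omega>"
    by (simp add: is_base_def BijGroup_simps)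
  then have "\<exists>n B. finite B \<and> card B = n \<and> is_base \<Omega> G B"
    using finite by blast
  then have "\<exists>B. finite B \<and> card B = base_size \<Omega> G \<and> is_base \<Omega> G B"
    unfolding base_size_def by (rule LeastI_ex)
  then obtain x y where base: "is_base \<Omega> G {x, y}"
    using base2 by (auto simp: card_2_iff)
  then have xy: "x \<in> \<Omega>" "y \<in> \<Omega>" by (auto simp: is_base_def)
  obtain g where g: "g \<in> G" "g x = \<alpha>" using transitive xy assms by blast
  have triv: "h = (\<lambda>x\<in>\<Omega>. x)" if "h \<in> G" "h x = x" "h y = y" for h
  proof -
    have "h \<in> {g \<in> G. \<forall>b\<in>{x, y}. g b = b}" using that by blast
    also have "\<dots> = {\<lambda>x\<in>\<Omega>. x}" using base by (simp add: is_base_def BijGroup_simps)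
    finally show ?thesis by simp
  qed
  have "h = (\<lambda>x\<in>\<Omega>. x)" if h: "h \<in> G" "h \<alpha> = \<alpha>" "h (g y) = g y" for h
    by (rule conj_eq_one[OF g(1) h(1)], rule triv)
      (use g h xy conj_closed conj_fixes_iff in \<open>simp_all\<close>)
  then have "g y \<in> saxl_nbrs \<Omega> G \<alpha>"
    using g xy closed assms by (simp add: saxl_nbrs_eq)
  then show ?thesis by blast
qed

end

section \<open>The product action of a wreath product\<close>

text \<open>\<open>W\<close> is the wreath product of \<open>G\<close> with the symmetric group on \<open>I\<close> in its product action on
  \<open>\<Omega>\<^sup>I\<close>, carried over along the injection \<open>\<phi>\<close>.\<close>

locale wreath = primitive_base2 \<Omega> G
  for \<Omega> :: "'a set" and G +
  fixes I :: "'i set" and \<phi> :: "('i \<Rightarrow> 'a) \<Rightarrow> 'b"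
  assumes finite_I: "finite I" and I_nonempty: "I \<noteq> {}"
    and inj_\<phi>: "inj_on \<phi> (I \<rightarrow>\<^sub>E \<Omega>)"
begin

abbreviation P :: "('i \<Rightarrow> 'a) set"
  where "P \<equiv> I \<rightarrow>\<^sub>E \<Omega>"

abbreviation Y :: "'b set"
  where "Y \<equiv> \<phi> ` P"

abbreviation e :: "'a \<Rightarrow> 'a"
  where "e \<equiv> \<lambda>x\<in>\<Omega>. x"

abbreviation pinv :: "('i \<Rightarrow> 'i) \<Rightarrow> 'i \<Rightarrow> 'i"
  where "pinv \<equiv> inv_into UNIV"

section \<open>Elements of the wreath product and the group they form\<close>

definition wr :: "('i \<Rightarrow> 'i) \<Rightarrow> ('i \<Rightarrow> 'a \<Rightarrow> 'a) \<Rightarrow> ('i \<Rightarrow> 'a) \<Rightarrow> 'i \<Rightarrow> 'a"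
  where "wr \<sigma> g x = (\<lambda>i\<in>I. g i (x (\<sigma> i)))"

text \<open>Acting on the copy \<open>Y\<close> instead of on \<open>P\<close> leaves the type
  \<open>'b\<close> free. It is later taken to be the type of points, so that a hypothesis about
  groups over that one type applies to \<open>W\<close>.\<close>

definition W :: "('b \<Rightarrow> 'b) set"
  where "W = {w \<in> Bij Y. \<exists>\<sigma> g. \<sigma> permutes I \<and> g \<in> I \<rightarrow> G \<and> (\<forall>x\<in>P. w (\<phi> x) = \<phi> (wr \<sigma> g x))}"

lemma \<phi>_eq_iff: "x \<in> P \<Longrightarrow> y \<in> P \<Longrightarrow> \<phi> x = \<phi> y \<longleftrightarrow> x = y"
  using inj_\<phi> by (simp add: inj_on_eq_iff)

lemma upd_in_P: "x \<in> P \<Longrightarrow> i \<in> I \<Longrightarrow> u \<in> \<Omega> \<Longrightarrow> x(i := u) \<in> P"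
  by (auto simp: PiE_iff extensional_def)

lemma const_in_P: "a \<in> \<Omega> \<Longrightarrow> (\<lambda>i\<in>I. a) \<in> P"
  by auto

lemma wr_closed:
  assumes "\<sigma> permutes I" "g \<in> I \<rightarrow> G" "x \<in> P"
  shows "wr \<sigma> g x \<in> P"
proof -
  have "g i (x (\<sigma> i)) \<in> \<Omega>" if "i \<in> I" for i
    using assms that permutes_in_image[OF assms(1)] by (intro closed[of "g i"]) auto
  then show ?thesis by (auto simp: wr_def)
qed

lemma wr_wr:
  assumes "\<sigma> permutes I" "\<tau> permutes I" "x \<in> P"
  shows "wr \<sigma> g (wr \<tau> h x) = wr (\<tau> \<circ> \<sigma>) (\<lambda>i. compose \<Omega> (g i) (h (\<sigma> i))) x"
proof
  fix i
  show "wr \<sigma> g (wr \<tau> h x) i = wr (\<tau> \<circ> \<sigma>) (\<lambda>i. compose \<Omega> (g i) (h (\<sigma> i))) x i"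
    using assms permutes_in_image[OF assms(1)] permutes_in_image[OF assms(2)]
    by (auto simp: wr_def compose_def)
qed

lemma wr_one: "x \<in> P \<Longrightarrow> wr id (\<lambda>_. e) x = x"
  by (rule PiE_ext[of _ I "\<lambda>_. \<Omega>"]) (auto simp: wr_def)

text \<open>Solving \<open>y i = g i (x (\<sigma> i))\<close> for \<open>x\<close> gives
  \<open>x j\<close> as the inverse of \<open>g (pinv \<sigma> j)\<close> applied to
  \<open>y (pinv \<sigma> j)\<close>.\<close>

definition wr_inv_comp :: "('i \<Rightarrow> 'i) \<Rightarrow> ('i \<Rightarrow> 'a \<Rightarrow> 'a) \<Rightarrow> 'i \<Rightarrow> 'a \<Rightarrow> 'a"
  where "wr_inv_comp \<sigma> g i = ginv (g (pinv \<sigma> i))"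

lemma wr_inv:
  assumes "\<sigma> permutes I" "g \<in> I \<rightarrow> G"
  shows "wr_inv_comp \<sigma> g \<in> I \<rightarrow> G"
    and "x \<in> P \<Longrightarrow> wr \<sigma> g (wr (pinv \<sigma>) (wr_inv_comp \<sigma> g) x) = x"
    and "x \<in> P \<Longrightarrow> wr (pinv \<sigma>) (wr_inv_comp \<sigma> g) (wr \<sigma> g x) = x"
proof -
  note \<sigma>' = permutes_inv[OF assms(1)]
  have mem: "\<sigma> i \<in> I \<longleftrightarrow> i \<in> I" "pinv \<sigma> i \<in> I \<longleftrightarrow> i \<in> I" for i
    using permutes_in_image[OF assms(1)] permutes_in_image[OF \<sigma>'] by auto
  show G: "wr_inv_comp \<sigma> g \<in> I \<rightarrow> G"
    using assms(2) mem by (auto simp: wr_inv_comp_def intro!: ginv_closed)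
  show "wr \<sigma> g (wr (pinv \<sigma>) (wr_inv_comp \<sigma> g) x) = x" if "x \<in> P"
  proof (rule PiE_ext[OF wr_closed[OF assms wr_closed[OF \<sigma>' G that]] that])
    fix i assume "i \<in> I"
    then have "g i \<in> G" "x i \<in> \<Omega>" using assms that by auto
    then show "wr \<sigma> g (wr (pinv \<sigma>) (wr_inv_comp \<sigma> g) x) i = x i"
      using \<open>i \<in> I\<close> mem permutes_inverses[OF assms(1)]
      by (simp add: wr_def wr_inv_comp_def ginv_right)
  qed
  show "wr (pinv \<sigma>) (wr_inv_comp \<sigma> g) (wr \<sigma> g x) = x" if "x \<in> P"
  proof (rule PiE_ext[OF wr_closed[OF \<sigma>' G wr_closed[OF assms that]] that])
    fix i assume "i \<in> I"
    then have "g (pinv \<sigma> i) \<in> G" "x i \<in> \<Omega>" using assms that mem by auto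
    then show "wr (pinv \<sigma>) (wr_inv_comp \<sigma> g) (wr \<sigma> g x) i = x i"
      using \<open>i \<in> I\<close> mem permutes_inverses[OF assms(1)]
      by (simp add: wr_def wr_inv_comp_def ginv_left)
  qed
qed

lemma W_elim:
  assumes "w \<in> W"
  obtains \<sigma> g where "\<sigma> permutes I" "g \<in> I \<rightarrow> G" "\<And>x. x \<in> P \<Longrightarrow> w (\<phi> x) = \<phi> (wr \<sigma> g x)"
  using assms unfolding W_def by blast

lemma W_obtain:
  assumes "\<sigma> permutes I" "g \<in> I \<rightarrow> G"
  obtains w where "w \<in> W" "\<And>x. x \<in> P \<Longrightarrow> w (\<phi> x) = \<phi> (wr \<sigma> g x)"
proof
  let ?w = "\<lambda>y\<in>Y. \<phi> (wr \<sigma> g (inv_into P \<phi> y))"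
  show w: "?w (\<phi> x) = \<phi> (wr \<sigma> g x)" if "x \<in> P" for x
    using that inj_\<phi> by (simp add: inv_into_f_f)
  have "bij_betw (wr \<sigma> g) P P"
    using assms wr_inv[OF assms] permutes_inv[OF assms(1)] wr_closed
    by (intro bij_betw_byWitness[where f' = "wr (pinv \<sigma>) (wr_inv_comp \<sigma> g)"]) blast+
  moreover have "bij_betw \<phi> P Y"
    using inj_\<phi> by (rule inj_on_imp_bij_betw)
  ultimately have "bij_betw (\<phi> \<circ> (wr \<sigma> g \<circ> inv_into P \<phi>)) Y Y"
    by (meson bij_betw_inv_into bij_betw_trans)
  then have "bij_betw ?w Y Y"
    by (subst bij_betw_cong[of _ _ "\<phi> \<circ> (wr \<sigma> g \<circ> inv_into P \<phi>)"]) auto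
  then have "?w \<in> Bij Y"
    unfolding Bij_def by blast
  then show "?w \<in> W"
    unfolding W_def using assms w by blast
qed

lemma subgroup_W: "subgroup W (BijGroup Y)"
  unfolding subgroup_BijGroup_iff
proof (intro conjI ballI)
  show "W \<subseteq> Bij Y" by (auto simp: W_def)
next
  have "(\<lambda>_. e) \<in> I \<rightarrow> G" using one_closed by simp
  moreover have "(\<lambda>y\<in>Y. y) (\<phi> x) = \<phi> (wr id (\<lambda>_. e) x)" if "x \<in> P" for x
    using that wr_one[OF that] by simp
  ultimately show "(\<lambda>y\<in>Y. y) \<in> W"
    unfolding W_def using id_Bij permutes_id by blast
next
  fix v w assume v: "v \<in> W" and w: "w \<in> W"
  obtain \<sigma> g where \<sigma>: "\<sigma> permutes I" and g: "g \<in> I \<rightarrow> G"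
    and v_eq: "\<And>x. x \<in> P \<Longrightarrow> v (\<phi> x) = \<phi> (wr \<sigma> g x)"
    using W_elim[OF v] by blast
  obtain \<tau> h where \<tau>: "\<tau> permutes I" and h: "h \<in> I \<rightarrow> G"
    and w_eq: "\<And>x. x \<in> P \<Longrightarrow> w (\<phi> x) = \<phi> (wr \<tau> h x)"
    using W_elim[OF w] by blast
  have "compose Y v w (\<phi> x) = \<phi> (wr (\<tau> \<circ> \<sigma>) (\<lambda>i. compose \<Omega> (g i) (h (\<sigma> i))) x)"
    if "x \<in> P" for x
    using that v_eq[OF wr_closed[OF \<tau> h that]] w_eq[OF that] wr_wr[OF \<sigma> \<tau> that]
    by (simp add: compose_eq)
  moreover have "(\<lambda>i. compose \<Omega> (g i) (h (\<sigma> i))) \<in> I \<rightarrow> G"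
    using g h permutes_in_image[OF \<sigma>] by (auto intro!: compose_closed)
  moreover have "compose Y v w \<in> Bij Y"
    using v w by (auto simp: W_def intro!: compose_Bij)
  ultimately show "compose Y v w \<in> W"
    unfolding W_def using permutes_compose[OF \<sigma> \<tau>] by blast
next
  fix w assume w: "w \<in> W"
  obtain \<sigma> g where \<sigma>: "\<sigma> permutes I" and g: "g \<in> I \<rightarrow> G"
    and w_eq: "\<And>x. x \<in> P \<Longrightarrow> w (\<phi> x) = \<phi> (wr \<sigma> g x)"
    using W_elim[OF w] by blast
  have Bij: "w \<in> Bij Y" using w by (simp add: W_def)
  have "restrict (inv_into Y w) Y (\<phi> x) = \<phi> (wr (pinv \<sigma>) (wr_inv_comp \<sigma> g) x)" if "x \<in> P" for x
  proof -
    have mem: "wr (pinv \<sigma>) (wr_inv_comp \<sigma> g) x \<in> P"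
      using that wr_inv(1)[OF \<sigma> g] permutes_inv[OF \<sigma>] by (intro wr_closed)
    have "inv_into Y w (\<phi> x) = \<phi> (wr (pinv \<sigma>) (wr_inv_comp \<sigma> g) x)"
      using Bij mem w_eq[OF mem] wr_inv(2)[OF \<sigma> g that]
      by (intro inv_into_f_eq) (auto simp: Bij_def bij_betw_def)
    then show ?thesis using that by simp
  qed
  then show "restrict (inv_into Y w) Y \<in> W"
    unfolding W_def
    using restrict_inv_into_Bij[OF Bij] permutes_inv[OF \<sigma>] wr_inv(1)[OF \<sigma> g] by blast
qed

sublocale prod: permutation_group Y W
  by (rule permutation_group.intro) (rule subgroup_W)

lemma wr_coord:
  assumes "i \<in> I" "x \<in> P"
  shows "wr id ((\<lambda>_. e)(i := g)) x = x(i := g (x i))"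
  using assms by (auto simp: wr_def fun_eq_iff PiE_iff extensional_def)

lemma coord_obtain:
  assumes "i \<in> I" "g \<in> G"
  obtains w where "w \<in> W" "\<And>x. x \<in> P \<Longrightarrow> w (\<phi> x) = \<phi> (x(i := g (x i)))"
proof -
  have "(\<lambda>_. e)(i := g) \<in> I \<rightarrow> G" using assms one_closed by auto
  then show thesis
    using W_obtain[OF permutes_id] wr_coord[OF assms(1)] that by metis
qed

section \<open>Transitivity and primitivity of the product action\<close>

lemma W_transitive:
  assumes "x \<in> P" "y \<in> P"
  shows "\<exists>w\<in>W. w (\<phi> x) = \<phi> y"
proof -
  have "\<forall>i\<in>I. \<exists>g\<in>G. g (x i) = y i"
    using assms by (auto intro!: transitive)
  then obtain g where g: "\<And>i. i \<in> I \<Longrightarrow> g i \<in> G \<and> g i (x i) = y i" by metis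
  then have G: "g \<in> I \<rightarrow> G" by auto
  obtain w where w: "w \<in> W" "\<And>x. x \<in> P \<Longrightarrow> w (\<phi> x) = \<phi> (wr id g x)"
    using W_obtain[OF permutes_id G] by blast
  have "wr id g x = y"
    by (rule PiE_ext[OF wr_closed[OF permutes_id G assms(1)] assms(2)]) (use g in \<open>simp add: wr_def\<close>)
  with w assms show ?thesis by metis
qed

text \<open>From two related tuples one first gets related tuples that differ in a single
  coordinate. The relation \<open>S\<close> that this induces on \<Omega> is then invariant and not
  equality, so it is universal by primitivity of \<open>G\<close>. Hence any coordinate may be
  changed freely within a class, and changing all of them joins any two tuples.\<close>

lemma W_blocks:
  assumes R: "equiv Y R" and R_inv: "\<And>w x y. w \<in> W \<Longrightarrow> (x, y) \<in> R \<Longrightarrow> (w x, w y) \<in> R"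
    and "R \<noteq> Id_on Y"
  shows "R = Y \<times> Y"
proof -
  define Q where "Q x y \<longleftrightarrow> (\<phi> x, \<phi> y) \<in> R" for x y
  have R_sub: "R \<subseteq> Y \<times> Y" using R by (rule equiv_type)
  have Q_refl: "Q x x" if "x \<in> P" for x
    using that R by (auto simp: Q_def equiv_def refl_on_def)
  have Q_sym: "Q y x" if "Q x y" for x y
    using that R by (auto simp: Q_def equiv_def dest: symD)
  have Q_trans: "Q x z" if "Q x y" "Q y z" for x y z
    using that R by (auto simp: Q_def equiv_def dest: transD)
  have Q_wr: "Q (wr \<sigma> g x) (wr \<sigma> g y)"
    if "\<sigma> permutes I" "g \<in> I \<rightarrow> G" "x \<in> P" "y \<in> P" "Q x y" for \<sigma> g x y
  proof -
    note * = that
    obtain w where "w \<in> W" "\<And>x. x \<in> P \<Longrightarrow> w (\<phi> x) = \<phi> (wr \<sigma> g x)"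
      using W_obtain[OF *(1,2)] by blast
    then show ?thesis using R_inv[of w "\<phi> x" "\<phi> y"] *(3-) unfolding Q_def by simp
  qed
  have Q_coord: "Q (x(i := g (x i))) (y(i := g (y i)))"
    if "i \<in> I" "g \<in> G" "x \<in> P" "y \<in> P" "Q x y" for i g x y
  proof -
    note * = that
    obtain w where "w \<in> W" "\<And>x. x \<in> P \<Longrightarrow> w (\<phi> x) = \<phi> (x(i := g (x i)))"
      using coord_obtain[OF *(1,2)] by blast
    then show ?thesis using R_inv[of w "\<phi> x" "\<phi> y"] *(3-) unfolding Q_def by simp
  qed
  \<comment> \<open>Acting by \<open>g\<close> in coordinate \<open>i\<close> fixes \<open>x\<close>
    and changes \<open>y\<close> in that coordinate only. Both \<open>y\<close> and its image are
    related to \<open>x\<close>, hence to each other.\<close>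
  have key: "\<exists>v\<in>\<Omega>. v \<noteq> y i \<and> Q y (y(i := v))"
    if "i \<in> I" "g \<in> G" "x \<in> P" "y \<in> P" "Q x y" "g (x i) = x i" "g (y i) \<noteq> y i" for i g x y
  proof -
    have "Q x (y(i := g (y i)))"
      using Q_coord[OF that(1-5)] that(6) by simp
    then have "Q y (y(i := g (y i)))"
      using Q_trans Q_sym that(5) by blast
    moreover have "g (y i) \<in> \<Omega>" using that by (intro closed[OF that(2)]) auto
    ultimately show ?thesis using that(7) by blast
  qed
  have "\<exists>x\<in>P. \<exists>y\<in>P. Q x y \<and> x \<noteq> y"
  proof (rule ccontr)
    assume "\<not> ?thesis"
    then have "R \<subseteq> Id_on Y" using R_sub unfolding Q_def by fastforce
    moreover have "Id_on Y \<subseteq> R" using Q_refl unfolding Q_def by auto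
    ultimately show False using \<open>R \<noteq> Id_on Y\<close> by blast
  qed
  then obtain x y where xy: "x \<in> P" "y \<in> P" "Q x y" "x \<noteq> y" by blast
  then obtain i where i: "i \<in> I" "x i \<noteq> y i" using PiE_ext by metis
  then obtain g where g: "g \<in> G" "(g (x i) = x i) \<noteq> (g (y i) = y i)"
    using stab_distinct[of "x i" "y i"] xy by auto
  \<comment> \<open>Applying \<open>g\<close> in coordinate \<open>i\<close> fixes one of \<open>x\<close>, \<open>y\<close> and moves the other in that
    coordinate only, which gives related points differing in a single coordinate.\<close>
  obtain z v where zv: "z \<in> P" "v \<in> \<Omega>" "v \<noteq> z i" "Q z (z(i := v))"
  proof (cases "g (x i) = x i")
    case True
    with g have "g (y i) \<noteq> y i" by simp
    with that show thesis using key[OF i(1) g(1) xy(1-3) True] xy(2) by blast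
  next
    case False
    with g have "g (y i) = y i" by simp
    with that show thesis using key[OF i(1) g(1) xy(2,1) Q_sym[OF xy(3)] _ False] xy(1) by blast
  qed
  \<comment> \<open>Quantifying over every tuple and every position makes the invariance of
    \<open>S\<close> under \<open>G\<close> a direct case of \<open>Q_coord\<close>. The price is
    that the single pair found above must be carried to all tuples and positions.\<close>
  define S where "S = {(u, v) \<in> \<Omega> \<times> \<Omega>. \<forall>z\<in>P. \<forall>j\<in>I. Q (z(j := u)) (z(j := v))}"
  have "equiv \<Omega> S"
  proof (rule equivI)
    show "S \<subseteq> \<Omega> \<times> \<Omega>" by (auto simp: S_def)
    show "refl_on \<Omega> S"
      by (rule refl_onI) (auto simp: S_def intro!: Q_refl upd_in_P)
    show "sym S" by (rule symI) (auto simp: S_def intro: Q_sym)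
    show "trans S"
    proof (rule transI)
      fix a b c assume "(a, b) \<in> S" "(b, c) \<in> S"
      then show "(a, c) \<in> S" unfolding S_def using Q_trans by blast
    qed
  qed
  moreover have "(g a, g b) \<in> S" if g: "g \<in> G" and ab: "(a, b) \<in> S" for g a b
  proof -
    have "Q (z(j := g a)) (z(j := g b))" if "z \<in> P" "j \<in> I" for z j
    proof -
      have "Q (z(j := a)) (z(j := b))" and "z(j := a) \<in> P" "z(j := b) \<in> P"
        using ab that by (auto simp: S_def intro!: upd_in_P)
      from Q_coord[OF that(2) g this(2,3,1)] show ?thesis by simp
    qed
    then show ?thesis using ab closed[OF g] by (auto simp: S_def)
  qed
  moreover have "S \<noteq> Id_on \<Omega>"
  proof -
    have zi: "z i \<in> \<Omega>" using zv i by auto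
    have "Q (t(j := z i)) (t(j := v))" if "t \<in> P" "j \<in> I" for t j
    proof -
      \<comment> \<open>The swap brings coordinate \<open>i\<close> of \<open>z\<close> to position
        \<open>j\<close>, where the identity keeps it. At the other positions \<open>h\<close> turns
        the permuted entries of \<open>z\<close> into those of \<open>t\<close>.\<close>
      define \<sigma> where "\<sigma> = transpose i j"
      have \<sigma>: "\<sigma> permutes I" unfolding \<sigma>_def using i that by (intro permutes_swap_id)
      have mem: "\<sigma> k \<in> I" if "k \<in> I" for k using permutes_in_image[OF \<sigma>] that by simp
      have "\<forall>k\<in>I. \<exists>h\<in>G. h (z (\<sigma> k)) = t k"
        using mem zv(1) that by (auto intro!: transitive)
      then obtain h where h: "\<And>k. k \<in> I \<Longrightarrow> h k \<in> G \<and> h k (z (\<sigma> k)) = t k" by metis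
      let ?h = "h(j := e)"
      have G: "?h \<in> I \<rightarrow> G" using h one_closed by auto
      have z': "z(i := v) \<in> P" using zv i by (intro upd_in_P)
      have "wr \<sigma> ?h z = t(j := z i)"
        by (rule PiE_ext[OF wr_closed[OF \<sigma> G zv(1)] upd_in_P[OF that zi]])
          (use h zi in \<open>auto simp: wr_def \<sigma>_def\<close>)
      \<comment> \<open>Only position \<open>j\<close> reads coordinate \<open>i\<close>, so
        replacing \<open>z i\<close> by \<open>v\<close> affects the image there and nowhere
        else.\<close>
      moreover have "\<sigma> k \<noteq> i" if "k \<noteq> j" for k
        using that by (auto simp: \<sigma>_def transpose_def)
      then have "wr \<sigma> ?h (z(i := v)) = t(j := v)"
        by (intro PiE_ext[OF wr_closed[OF \<sigma> G z'] upd_in_P[OF that zv(2)]])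
          (use h zv(2) in \<open>auto simp: wr_def \<sigma>_def\<close>)
      ultimately show ?thesis
        using Q_wr[OF \<sigma> G zv(1) z' zv(4)] by simp
    qed
    then have "(z i, v) \<in> S" using zi zv by (simp add: S_def)
    then show ?thesis using zv(3) by auto
  qed
  ultimately have S: "S = \<Omega> \<times> \<Omega>" using blocks[of S] by presburger
  have Q_upd: "Q z (z(j := u))" if "z \<in> P" "j \<in> I" "u \<in> \<Omega>" for z j u
  proof -
    have "(z j, u) \<in> S" using that S by auto
    then have "Q (z(j := z j)) (z(j := u))" using that unfolding S_def by blast
    then show ?thesis by simp
  qed
  have "Q x y" if x: "x \<in> P" and y: "y \<in> P" for x y
  proof -
    \<comment> \<open>Induction on the set \<open>J\<close> of positions at which \<open>x\<close>
      has already been replaced by \<open>y\<close>.\<close>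
    have "override_on x y J \<in> P \<and> Q x (override_on x y J)" if "finite J" "J \<subseteq> I" for J
      using that
    proof (induction J rule: finite_induct)
      case empty
      then show ?case using x Q_refl by simp
    next
      case (insert j J)
      let ?z = "override_on x y J"
      have j: "j \<in> I" and z: "?z \<in> P" "Q x ?z"
        using insert.IH insert.prems by simp_all
      have yj: "y j \<in> \<Omega>" using y j by (rule PiE_mem)
      have "?z(j := y j) \<in> P" using z(1) j yj by (rule upd_in_P)
      moreover have "Q x (?z(j := y j))"
        using z(2) Q_upd[OF z(1) j yj] by (rule Q_trans)
      ultimately show ?case by (simp only: override_on_insert)
    qed
    from this[OF finite_I subset_refl] have "Q x (override_on x y I)" "override_on x y I \<in> P"
      by simp_all
    moreover from this(2) have "override_on x y I = y"
      by (rule PiE_ext[OF _ y]) simp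
    ultimately show ?thesis by simp
  qed
  then have "Y \<times> Y \<subseteq> R" unfolding Q_def by auto
  with R_sub show ?thesis by (rule subset_antisym)
qed

lemma primitive_W: "primitive_group Y W"
  unfolding primitive_group_iff
proof (intro conjI allI impI)
  show "Y \<noteq> {}" using nonempty by (auto simp: PiE_eq_empty_iff)
  show "subgroup W (BijGroup Y)" by (rule subgroup_W)
  show "\<forall>x\<in>Y. \<forall>y\<in>Y. \<exists>w\<in>W. w x = y"
    using W_transitive by simp
  fix R assume R: "equiv Y R \<and> (\<forall>w\<in>W. \<forall>(x, y)\<in>R. (w x, w y) \<in> R)"
  have "R = Y \<times> Y" if "R \<noteq> Id_on Y"
    by (rule W_blocks) (use R that in auto)
  then show "R = Id_on Y \<or> R = Y \<times> Y" by blast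
qed

section \<open>Neighbours of constant tuples and the base size of \<open>W\<close>\<close>

lemma coord_eq_one:
  assumes "i \<in> I" "g \<in> G" "w \<in> W" "\<And>x. x \<in> P \<Longrightarrow> w (\<phi> x) = \<phi> (x(i := g (x i)))"
    and "w = (\<lambda>y\<in>Y. y)"
  shows "g = e"
proof (rule eqI[OF assms(2) one_closed])
  fix u assume u: "u \<in> \<Omega>"
  then have x: "(\<lambda>i\<in>I. u) \<in> P" by (rule const_in_P)
  have "\<phi> ((\<lambda>i\<in>I. u)(i := g u)) = \<phi> (\<lambda>i\<in>I. u)"
    using assms(4)[OF x] assms(1,5) x by simp
  moreover have "(\<lambda>i\<in>I. u)(i := g u) \<in> P"
    using x assms(1) closed[OF assms(2) u] by (rule upd_in_P)
  ultimately have "(\<lambda>i\<in>I. u)(i := g u) = (\<lambda>i\<in>I. u)"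
    using \<phi>_eq_iff x by blast
  then have "((\<lambda>i\<in>I. u)(i := g u)) i = (\<lambda>i\<in>I. u) i" by (rule fun_cong)
  then show "g u = e u" using assms(1) u by simp
qed

text \<open>An element fixing \<open>a\<close> and \<open>c i\<close>, used in coordinate
  \<open>i\<close> alone, fixes both tuples and so is trivial. If \<open>c i = h (c j)\<close> with
  \<open>h\<close> fixing \<open>a\<close>, then swapping positions \<open>i\<close> and
  \<open>j\<close>, corrected by \<open>h\<close> and its inverse, fixes both tuples without being
  the identity.\<close>

lemma saxl_nbrs_W_D:
  assumes a: "a \<in> \<Omega>" and c: "c \<in> P" and nbr: "\<phi> c \<in> saxl_nbrs Y W (\<phi> (\<lambda>i\<in>I. a))"
  shows "i \<in> I \<Longrightarrow> c i \<in> saxl_nbrs \<Omega> G a"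
    and "i \<in> I \<Longrightarrow> j \<in> I \<Longrightarrow> i \<noteq> j \<Longrightarrow> c i \<notin> stab_orbit a (c j)"
proof -
  let ?a = "\<lambda>i\<in>I. a"
  have a': "?a \<in> P" using a by (rule const_in_P)
  have triv: "w = (\<lambda>y\<in>Y. y)" if "w \<in> W" "w (\<phi> ?a) = \<phi> ?a" "w (\<phi> c) = \<phi> c" for w
    using nbr that a' by (simp add: prod.saxl_nbrs_eq)
  show "c i \<in> saxl_nbrs \<Omega> G a" if i: "i \<in> I"
  proof -
    have "g = e" if g: "g \<in> G" "g a = a" "g (c i) = c i" for g
    proof -
      obtain w where w: "w \<in> W" "\<And>x. x \<in> P \<Longrightarrow> w (\<phi> x) = \<phi> (x(i := g (x i)))"
        using coord_obtain[OF i g(1)] by blast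
      have "?a(i := a) = ?a" using i by auto
      then have "w (\<phi> ?a) = \<phi> ?a" "w (\<phi> c) = \<phi> c"
        using w(2)[OF a'] w(2)[OF c] g i by simp_all
      then have "w = (\<lambda>y\<in>Y. y)" using triv w(1) by blast
      with i g(1) w show ?thesis by (rule coord_eq_one)
    qed
    then show ?thesis using a c i by (auto simp: saxl_nbrs_eq)
  qed
  show "c i \<notin> stab_orbit a (c j)" if ij: "i \<in> I" "j \<in> I" "i \<noteq> j"
  proof
    assume "c i \<in> stab_orbit a (c j)"
    then obtain h where h: "h \<in> G" "h a = a" "c i = h (c j)"
      by (auto simp: stab_orbit_def)
    have h': "ginv h \<in> G" "ginv h a = a" "ginv h (c i) = c j"
      using h c ij a ginv_closed ginv_left[OF h(1)] by (auto simp: PiE_iff) metis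
    define \<sigma> where "\<sigma> = transpose i j"
    define g where "g = (\<lambda>_. e)(i := h, j := ginv h)"
    have \<sigma>: "\<sigma> permutes I" unfolding \<sigma>_def using ij by (intro permutes_swap_id)
    have G: "g \<in> I \<rightarrow> G" using h h' one_closed by (auto simp: g_def)
    obtain w where w: "w \<in> W" "\<And>x. x \<in> P \<Longrightarrow> w (\<phi> x) = \<phi> (wr \<sigma> g x)"
      using W_obtain[OF \<sigma> G] by blast
    have "wr \<sigma> g c = c"
      by (rule PiE_ext[OF wr_closed[OF \<sigma> G c] c])
        (use h h' ij c in \<open>auto simp: wr_def \<sigma>_def g_def transpose_def\<close>)
    moreover have "wr \<sigma> g ?a = ?a"
      by (rule PiE_ext[OF wr_closed[OF \<sigma> G a'] a'])
        (use h h' ij a in \<open>auto simp: wr_def \<sigma>_def g_def transpose_def\<close>)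
    ultimately have one: "w = (\<lambda>y\<in>Y. y)"
      using triv w a' c by simp
    \<comment> \<open>The test tuple deviates from the constant one only at \<open>j\<close>. The
      swap carries the deviation to position \<open>i\<close>, so fixing the tuple would force
      \<open>h u = h a\<close>.\<close>
    obtain u where u: "u \<in> \<Omega>" "u \<noteq> a" using ex_distinct by metis
    let ?x = "?a(j := u)"
    have x: "?x \<in> P" using a' ij(2) u(1) by (rule upd_in_P)
    have "\<phi> (wr \<sigma> g ?x) = \<phi> ?x" using w(2)[OF x] one x by simp
    then have "wr \<sigma> g ?x = ?x" using \<phi>_eq_iff wr_closed[OF \<sigma> G x] x by blast
    then have "wr \<sigma> g ?x i = ?x i" by simp
    then have "h u = h a"
      using ij h(2) by (simp add: wr_def \<sigma>_def g_def transpose_def)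
    then show False using inj[OF h(1) u(1) a] u(2) by simp
  qed
qed

text \<open>If the element given by \<sigma> and \<open>g\<close> fixes both tuples, then
  \<open>g i\<close> fixes \<open>a\<close> and takes \<open>c (\<sigma> i)\<close> to
  \<open>c i\<close>. As the orbits are distinct, \<open>\<sigma> i = i\<close>; then
  \<open>g i\<close> fixes both \<open>a\<close> and its neighbour \<open>c i\<close>, so it is
  trivial.\<close>

lemma saxl_nbrs_W_I:
  assumes a: "a \<in> \<Omega>" and c: "c \<in> P"
    and nbr: "\<And>i. i \<in> I \<Longrightarrow> c i \<in> saxl_nbrs \<Omega> G a"
    and orb: "\<And>i j. i \<in> I \<Longrightarrow> j \<in> I \<Longrightarrow> i \<noteq> j \<Longrightarrow> c i \<notin> stab_orbit a (c j)"
  shows "\<phi> c \<in> saxl_nbrs Y W (\<phi> (\<lambda>i\<in>I. a))"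
proof -
  let ?a = "\<lambda>i\<in>I. a"
  have a': "?a \<in> P" using a by (rule const_in_P)
  have "w = (\<lambda>y\<in>Y. y)" if w: "w \<in> W" "w (\<phi> ?a) = \<phi> ?a" "w (\<phi> c) = \<phi> c" for w
  proof -
    obtain \<sigma> g where \<sigma>: "\<sigma> permutes I" and g: "g \<in> I \<rightarrow> G"
      and w_eq: "\<And>x. x \<in> P \<Longrightarrow> w (\<phi> x) = \<phi> (wr \<sigma> g x)"
      using W_elim[OF w(1)] by blast
    have wa: "wr \<sigma> g ?a = ?a" and wc: "wr \<sigma> g c = c"
      using w w_eq a' c \<phi>_eq_iff wr_closed[OF \<sigma> g] by metis+
    have *: "\<sigma> i = i \<and> g i = e" if i: "i \<in> I" for i
    proof -
      have \<sigma>i: "\<sigma> i \<in> I" using permutes_in_image[OF \<sigma>] i by simp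
      have gi: "g i \<in> G" using g i by auto
      have "wr \<sigma> g ?a i = ?a i" "wr \<sigma> g c i = c i" using wa wc by simp_all
      then have gi_fix: "g i a = a" "g i (c (\<sigma> i)) = c i"
        using i \<sigma>i by (simp_all add: wr_def)
      then have "c i \<in> stab_orbit a (c (\<sigma> i))"
        unfolding stab_orbit_def using gi by (intro CollectI exI[of _ "g i"]) simp
      then have "\<sigma> i = i" using orb i \<sigma>i by metis
      moreover from this have "g i = e"
        using nbr[OF i] a gi_fix gi by (simp add: saxl_nbrs_eq)
      ultimately show ?thesis by blast
    qed
    have "wr \<sigma> g x = x" if x: "x \<in> P" for x
      by (rule PiE_ext[OF wr_closed[OF \<sigma> g x] x]) (use * x in \<open>auto simp: wr_def\<close>)
    then show ?thesis
      using w_eq by (intro prod.eqI[OF w(1) prod.one_closed]) auto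
  qed
  then show ?thesis using a' c by (simp add: prod.saxl_nbrs_eq)
qed

text \<open>The neighbour supplies a base of two points. One point is never a base, since a
  nontrivial element fixing one of its coordinates can act in that coordinate alone.\<close>

lemma base_size_W:
  assumes a: "a \<in> \<Omega>" and c: "c \<in> P" and nbr: "\<phi> c \<in> saxl_nbrs Y W (\<phi> (\<lambda>i\<in>I. a))"
  shows "base_size Y W = 2"
proof (rule base_size_eq_2)
  have "\<phi> (\<lambda>i\<in>I. a) \<in> Y" using const_in_P[OF a] by blast
  then show "is_base Y W {\<phi> (\<lambda>i\<in>I. a), \<phi> c}"
    using nbr c by (simp add: is_base_iff_saxl_nbrs)
next
  fix \<gamma> assume "\<gamma> \<in> Y"
  then obtain x where x: "x \<in> P" "\<gamma> = \<phi> x" by blast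
  obtain i where i: "i \<in> I" using I_nonempty by blast
  then obtain g where g: "g \<in> G" "g (x i) = x i" "g \<noteq> e"
    using nontrivial_stab[of "x i"] x by auto
  obtain w where w: "w \<in> W" "\<And>x. x \<in> P \<Longrightarrow> w (\<phi> x) = \<phi> (x(i := g (x i)))"
    using coord_obtain[OF i g(1)] by blast
  show "\<not> is_base Y W {\<gamma>}"
  proof
    assume "is_base Y W {\<gamma>}"
    then have "{w \<in> W. w \<gamma> = \<gamma>} = {\<lambda>y\<in>Y. y}"
      by (simp add: is_base_def BijGroup_simps)
    moreover have "x(i := g (x i)) = x" using g(2) by simp
    then have "w \<gamma> = \<gamma>" using w(2)[OF x(1)] x(2) by simp
    ultimately have "w \<in> {\<lambda>y\<in>Y. y}"
      using w(1) by blast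
    then have "g = e"
      by (intro coord_eq_one[OF i g(1) w singletonD])
    with g(3) show False by blast
  qed
qed

end

section \<open>Common neighbours versus regular orbits: both directions\<close>

lemma saxl_nbrs_meets_regular_orbit:
  fixes \<Omega> :: "'a :: infinite set"
  assumes common: "\<And>(\<Omega> :: 'a set) G \<alpha> \<beta>. finite \<Omega> \<Longrightarrow> primitive_group \<Omega> G \<Longrightarrow> base_size \<Omega> G = 2 \<Longrightarrow>
      \<alpha> \<in> \<Omega> \<Longrightarrow> \<beta> \<in> \<Omega> \<Longrightarrow> saxl_nbrs \<Omega> G \<alpha> \<inter> saxl_nbrs \<Omega> G \<beta> \<noteq> {}"
    and "primitive_base2 \<Omega> G" and \<alpha>: "\<alpha> \<in> \<Omega>" and \<beta>: "\<beta> \<in> \<Omega>"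
    and D: "D \<in> regular_orbits \<Omega> (point_stab \<Omega> G \<beta>)"
  shows "saxl_nbrs \<Omega> G \<alpha> \<inter> D \<noteq> {}"
proof -
  interpret primitive_base2 \<Omega> G by fact
  define I where "I = regular_orbits \<Omega> (point_stab \<Omega> G \<beta>)"
  have I_eq: "I = stab_orbit \<beta> ` saxl_nbrs \<Omega> G \<beta>"
    unfolding I_def using \<beta> by (rule regular_orbits_eq)
  have sub: "saxl_nbrs \<Omega> G \<beta> \<subseteq> \<Omega>" by (auto simp: saxl_nbrs_def)
  have fin_I: "finite I"
    unfolding I_eq using finite_subset[OF sub finite] by blast
  have fin_P: "finite (I \<rightarrow>\<^sub>E \<Omega>)" using fin_I finite by (intro finite_PiE)
  \<comment> \<open>The type \<open>'a\<close> is infinite, so the finite set of tuples embeds into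
    it and \<open>common\<close> can be applied to the wreath product.\<close>
  then obtain \<phi> :: "('a set \<Rightarrow> 'a) \<Rightarrow> 'a" where \<phi>: "inj_on \<phi> (I \<rightarrow>\<^sub>E \<Omega>)"
    using arb_inj_on_finite_infinite by blast
  interpret wreath \<Omega> G I \<phi>
    using fin_I D \<phi> by unfold_locales (auto simp: I_def)
  \<comment> \<open>One representative of each regular orbit: these form a tuple adjacent to the
    constant tuple of \<beta>, which settles the base size.\<close>
  have "\<forall>E\<in>I. \<exists>c. c \<in> saxl_nbrs \<Omega> G \<beta> \<and> stab_orbit \<beta> c = E"
    unfolding I_eq by auto
  then obtain c where c: "\<And>E. E \<in> I \<Longrightarrow> c E \<in> saxl_nbrs \<Omega> G \<beta> \<and> stab_orbit \<beta> (c E) = E" by metis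
  define c' where "c' = restrict c I"
  have "c' \<in> P" using c sub by (auto simp: c'_def)
  moreover have "c' E \<notin> stab_orbit \<beta> (c' E')" if "E \<in> I" "E' \<in> I" "E \<noteq> E'" for E E'
  proof
    assume "c' E \<in> stab_orbit \<beta> (c' E')"
    then have "stab_orbit \<beta> (c E) = stab_orbit \<beta> (c E')"
      using stab_orbit_cong[OF \<beta>] c[OF that(2)] sub that by (auto simp: c'_def)
    with c that show False by auto
  qed
  moreover have "c' E \<in> saxl_nbrs \<Omega> G \<beta>" if "E \<in> I" for E
    using c that by (simp add: c'_def)
  ultimately have "base_size Y W = 2"
    using base_size_W[OF \<beta>, of c'] saxl_nbrs_W_I[OF \<beta>, of c'] by blast
  then have "saxl_nbrs Y W (\<phi> (\<lambda>i\<in>I. \<alpha>)) \<inter> saxl_nbrs Y W (\<phi> (\<lambda>i\<in>I. \<beta>)) \<noteq> {}"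
    using fin_P by (intro common primitive_W imageI const_in_P \<alpha> \<beta> finite_imageI)
  then obtain d where d: "d \<in> P"
    and d\<alpha>: "\<phi> d \<in> saxl_nbrs Y W (\<phi> (\<lambda>i\<in>I. \<alpha>))" and d\<beta>: "\<phi> d \<in> saxl_nbrs Y W (\<phi> (\<lambda>i\<in>I. \<beta>))"
    by (auto simp: saxl_nbrs_def)
  have d\<Omega>: "d i \<in> \<Omega>" if "i \<in> I" for i using d that by auto
  \<comment> \<open>Sending \<open>i\<close> to the orbit of \<open>d i\<close> is an injective map
    of the finite set \<open>I\<close> to itself, hence onto, so some coordinate of \<open>d\<close>
    lies in \<open>D\<close>.\<close>
  have "inj_on (\<lambda>i. stab_orbit \<beta> (d i)) I"
  proof (rule inj_onI, rule ccontr)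
    fix i j assume ij: "i \<in> I" "j \<in> I" "stab_orbit \<beta> (d i) = stab_orbit \<beta> (d j)" "i \<noteq> j"
    then have "d i \<in> stab_orbit \<beta> (d j)"
      using stab_orbit_refl[OF \<beta> d\<Omega>[OF ij(1)]] by simp
    with saxl_nbrs_W_D(2)[OF \<beta> d d\<beta>] ij show False by blast
  qed
  moreover have "(\<lambda>i. stab_orbit \<beta> (d i)) ` I \<subseteq> I"
    using saxl_nbrs_W_D(1)[OF \<beta> d d\<beta>] I_eq by blast
  ultimately have "(\<lambda>i. stab_orbit \<beta> (d i)) ` I = I"
    using fin_I by (simp add: endo_inj_surj)
  moreover have "D \<in> I" using D by (simp add: I_def)
  ultimately obtain i where "i \<in> I" "D = stab_orbit \<beta> (d i)" by blast
  then show ?thesis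
    using saxl_nbrs_W_D(1)[OF \<alpha> d d\<alpha>] stab_orbit_refl[OF \<beta> d\<Omega>] by blast
qed

text \<open>Some neighbour of \<beta> exists, and its orbit under the stabiliser of \<beta> is
  regular and consists of neighbours of \<beta>. Any point where this orbit meets the neighbourhood
  of \<alpha> will do.\<close>

lemma (in primitive_base2) common_neighbour:
  assumes \<beta>: "\<beta> \<in> \<Omega>"
    and meets: "\<And>D. D \<in> regular_orbits \<Omega> (point_stab \<Omega> G \<beta>) \<Longrightarrow> saxl_nbrs \<Omega> G \<alpha> \<inter> D \<noteq> {}"
  shows "saxl_nbrs \<Omega> G \<alpha> \<inter> saxl_nbrs \<Omega> G \<beta> \<noteq> {}"
proof -
  obtain \<gamma> where \<gamma>: "\<gamma> \<in> saxl_nbrs \<Omega> G \<beta>" using saxl_nbrs_nonempty[OF \<beta>] by blast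
  then have "stab_orbit \<beta> \<gamma> \<in> regular_orbits \<Omega> (point_stab \<Omega> G \<beta>)"
    using regular_orbits_eq[OF \<beta>] by blast
  then have "saxl_nbrs \<Omega> G \<alpha> \<inter> stab_orbit \<beta> \<gamma> \<noteq> {}" by (rule meets)
  then show ?thesis using stab_orbit_saxl_nbrs[OF \<beta> \<gamma>] by blast
qed

theorem proposition5p9:
  shows "(\<forall>(\<Omega> :: 'a :: infinite set) G.
            finite \<Omega> \<and> primitive_group \<Omega> G \<and> base_size \<Omega> G = 2 \<longrightarrow>
            (\<forall>\<alpha>\<in>\<Omega>. \<forall>\<beta>\<in>\<Omega>. saxl_nbrs \<Omega> G \<alpha> \<inter> saxl_nbrs \<Omega> G \<beta> \<noteq> {}))
         \<longleftrightarrow>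
         (\<forall>(\<Omega> :: 'a set) G.
            finite \<Omega> \<and> primitive_group \<Omega> G \<and> base_size \<Omega> G = 2 \<longrightarrow>
            (\<forall>\<alpha>\<in>\<Omega>. \<forall>\<beta>\<in>\<Omega>. \<forall>D \<in> regular_orbits \<Omega> (point_stab \<Omega> G \<beta>).
               saxl_nbrs \<Omega> G \<alpha> \<inter> D \<noteq> {}))"
  (is "?A \<longleftrightarrow> ?B")
proof -
  have locale_iff: "primitive_base2 \<Omega> G \<longleftrightarrow>
      finite \<Omega> \<and> primitive_group \<Omega> G \<and> base_size \<Omega> G = 2" for \<Omega> :: "'a set" and G
    by (auto simp: primitive_base2_def primitive_base2_axioms_def permutation_group_def
        primitive_group_def)
  show ?thesis
  proof
    assume A: ?A
    show ?B
    proof (intro allI impI ballI)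
      fix \<Omega> :: "'a set" and G \<alpha> \<beta> D
      assume *: "finite \<Omega> \<and> primitive_group \<Omega> G \<and> base_size \<Omega> G = 2"
        and "\<alpha> \<in> \<Omega>" "\<beta> \<in> \<Omega>" "D \<in> regular_orbits \<Omega> (point_stab \<Omega> G \<beta>)"
      moreover from * have "primitive_base2 \<Omega> G" by (simp only: locale_iff)
      ultimately show "saxl_nbrs \<Omega> G \<alpha> \<inter> D \<noteq> {}"
        by (intro saxl_nbrs_meets_regular_orbit[OF A[rule_format]] conjI)
    qed
  next
    assume B: ?B
    show ?A
    proof (intro allI impI ballI)
      fix \<Omega> :: "'a set" and G \<alpha> \<beta>
      assume *: "finite \<Omega> \<and> primitive_group \<Omega> G \<and> base_size \<Omega> G = 2"
        and \<alpha>: "\<alpha> \<in> \<Omega>" and \<beta>: "\<beta> \<in> \<Omega>"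
      then have "primitive_base2 \<Omega> G" by (simp only: locale_iff)
      then show "saxl_nbrs \<Omega> G \<alpha> \<inter> saxl_nbrs \<Omega> G \<beta> \<noteq> {}"
        using \<beta> B[rule_format, OF * \<alpha> \<beta>] by (rule primitive_base2.common_neighbour)
    qed
  qed
qed

end
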